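(* The isometry group $\operatorname{Iso}(A(\overline U))$ and the automorphism group $\operatorname{Aut}(A(\overline U))$ of the disc algebra $A(\overline U)$ are topologically reflexive.
   Context: $U$ is the open unit disc in $\mathbb C$, and the disc algebra $A(\overline U)$ is the Banach algebra of all continuous functions $\overline U\to\mathbb C$ which are holomorphic in $U$, with the sup-norm. For a Banach algebra $\mathscr A$: $\operatorname{Iso}(\mathscr A)$ is the group of all surjective linear isometries; $\operatorname{Aut}(\mathscr A)$ is the group of all continuous (linear) algebra automorphisms; $B(\mathscr A)$ is the algebra of all continuous linear operators on $\mathscr A$. For $\mathscr S\subset B(\mathscr A)$ put $\operatorname{ref}_{to}\mathscr S=\{T\in B(\mathscr A): Tx\in\overline{\{Lx:L\in\mathscr S\}}\text{ for all }x\in\mathscr A\}$ (closure in $\mathscr A$); $\mathscr S$ is topologically reflexive if $\operatorname{ref}_{to}\mathscr S=\mathscr S$. *)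

theory Defs
  imports "HOL-Complex_Analysis.Complex_Analysis"
begin

section \<open>Complex Banach algebras and topological reflexivity\<close>

text \<open>The type classes of HOL-Analysis only provide real scalars, so complex scalar
  multiplication is added on top of a real Banach algebra.\<close>

class complex_banach_algebra = banach + real_normed_algebra +
  fixes scaleC :: "complex \<Rightarrow> 'a \<Rightarrow> 'a" (infixr \<open>*\<^sub>C\<close> 75)
  assumes scaleC_add_right: "a *\<^sub>C (x + y) = a *\<^sub>C x + a *\<^sub>C y"
    and scaleC_add_left: "(a + b) *\<^sub>C x = a *\<^sub>C x + b *\<^sub>C x"
    and scaleC_scaleC: "a *\<^sub>C (b *\<^sub>C x) = (a * b) *\<^sub>C x"
    and scaleC_of_real: "complex_of_real r *\<^sub>C x = r *\<^sub>R x"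
    and mult_scaleC_left: "(a *\<^sub>C x) * y = a *\<^sub>C (x * y)"
    and mult_scaleC_right: "x * (a *\<^sub>C y) = a *\<^sub>C (x * y)"
    and norm_scaleC: "norm (a *\<^sub>C x) = cmod a * norm x"

definition bounded_operators :: "('a::complex_banach_algebra \<Rightarrow> 'a) set" where
  "bounded_operators = {T. bounded_linear T \<and> (\<forall>c x. T (c *\<^sub>C x) = c *\<^sub>C T x)}"

definition isometry_group :: "('a::complex_banach_algebra \<Rightarrow> 'a) set" where
  "isometry_group = {T \<in> bounded_operators. surj T \<and> (\<forall>x. norm (T x) = norm x)}"

text \<open>For a bijective \<open>T\<close> continuity of the inverse need not be required: it follows from
  the open mapping theorem.\<close>

definition automorphism_group :: "('a::complex_banach_algebra \<Rightarrow> 'a) set" where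
  "automorphism_group = {T \<in> bounded_operators. bij T \<and> (\<forall>x y. T (x * y) = T x * T y)}"

definition ref_to :: "('a::complex_banach_algebra \<Rightarrow> 'a) set \<Rightarrow> ('a \<Rightarrow> 'a) set" where
  "ref_to S = {T \<in> bounded_operators. \<forall>x. T x \<in> closure {L x |L. L \<in> S}}"

definition topologically_reflexive :: "('a::complex_banach_algebra \<Rightarrow> 'a) set \<Rightarrow> bool" where
  "topologically_reflexive S \<longleftrightarrow> S \<subseteq> bounded_operators \<and> ref_to S = S"


section \<open>The disc algebra\<close>

text \<open>A continuous function on the closed disc is represented by its extension by zero to
  the whole plane, so that equality of representatives is equality on the closed disc.\<close>

typedef disc_algebra = "{f :: complex \<Rightarrow> complex.
    continuous_on (cball 0 1) f \<and> f holomorphic_on ball 0 1 \<and> (\<forall>z. z \<notin> cball 0 1 \<longrightarrow> f z = 0)}"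
  morphisms disc_fun Abs_disc_algebra
  by (rule exI[of _ "\<lambda>_. 0"]) auto

setup_lifting type_definition_disc_algebra

lemma continuous_disc_fun: "continuous_on (cball 0 1) (disc_fun f)"
  and holomorphic_disc_fun: "disc_fun f holomorphic_on ball 0 1"
  and disc_fun_outside: "z \<notin> cball 0 1 \<Longrightarrow> disc_fun f z = 0"
  using disc_fun[of f] by auto

lemma disc_algebra_eqI:
  assumes "\<And>z. z \<in> cball 0 1 \<Longrightarrow> disc_fun f z = disc_fun g z"
  shows "f = g"
proof -
  have "disc_fun f z = disc_fun g z" for z
    using assms disc_fun_outside by (cases "z \<in> cball 0 1") auto
  then show ?thesis by (simp add: disc_fun_inject[symmetric] fun_eq_iff)
qed

lemma bdd_above_disc_fun: "bdd_above ((\<lambda>z. cmod (disc_fun f z)) ` cball 0 1)"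
proof -
  have "compact ((\<lambda>z. cmod (disc_fun f z)) ` cball 0 1)"
    by (intro compact_continuous_image continuous_on_norm continuous_disc_fun compact_cball)
  then show ?thesis by (intro bounded_imp_bdd_above compact_imp_bounded)
qed

instantiation disc_algebra :: "{real_normed_algebra_1, comm_ring_1}"
begin

lift_definition zero_disc_algebra :: disc_algebra is "\<lambda>_. 0" by auto

lift_definition one_disc_algebra :: disc_algebra is "\<lambda>z. if z \<in> cball 0 1 then 1 else 0"
proof -
  have "continuous_on (cball 0 1) (\<lambda>z::complex. if z \<in> cball 0 1 then 1 else 0 :: complex)"
    by (rule continuous_on_eq[OF continuous_on_const[of _ 1]]) auto
  moreover have "(\<lambda>z. if z \<in> cball 0 1 then 1 else 0 :: complex) holomorphic_on ball 0 1"
    by (rule holomorphic_transform[OF holomorphic_on_const[of 1]]) auto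
  ultimately show "continuous_on (cball 0 1) (\<lambda>z::complex. if z \<in> cball 0 1 then 1 else 0 :: complex) \<and>
      (\<lambda>z. if z \<in> cball 0 1 then 1 else 0 :: complex) holomorphic_on ball 0 1 \<and>
      (\<forall>z::complex. z \<notin> cball 0 1 \<longrightarrow> (if z \<in> cball 0 1 then 1 else 0) = (0::complex))"
    by auto
qed

lift_definition plus_disc_algebra :: "disc_algebra \<Rightarrow> disc_algebra \<Rightarrow> disc_algebra"
  is "\<lambda>f g z. f z + g z" by (auto intro!: continuous_intros holomorphic_intros)

lift_definition minus_disc_algebra :: "disc_algebra \<Rightarrow> disc_algebra \<Rightarrow> disc_algebra"
  is "\<lambda>f g z. f z - g z" by (auto intro!: continuous_intros holomorphic_intros)

lift_definition uminus_disc_algebra :: "disc_algebra \<Rightarrow> disc_algebra"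
  is "\<lambda>f z. - f z" by (auto intro!: continuous_intros holomorphic_intros)

lift_definition times_disc_algebra :: "disc_algebra \<Rightarrow> disc_algebra \<Rightarrow> disc_algebra"
  is "\<lambda>f g z. f z * g z" by (auto intro!: continuous_intros holomorphic_intros)

lift_definition scaleR_disc_algebra :: "real \<Rightarrow> disc_algebra \<Rightarrow> disc_algebra"
  is "\<lambda>r f z. complex_of_real r * f z" by (auto intro!: continuous_intros holomorphic_intros)

definition norm_disc_algebra :: "disc_algebra \<Rightarrow> real" where
  "norm_disc_algebra f = (SUP z\<in>cball 0 1. cmod (disc_fun f z))"

definition sgn_disc_algebra :: "disc_algebra \<Rightarrow> disc_algebra" where
  "sgn_disc_algebra f = inverse (norm f) *\<^sub>R f"

definition dist_disc_algebra :: "disc_algebra \<Rightarrow> disc_algebra \<Rightarrow> real" where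
  "dist_disc_algebra f g = norm (f - g)"

definition uniformity_disc_algebra :: "(disc_algebra \<times> disc_algebra) filter" where
  "uniformity_disc_algebra = (INF e\<in>{0<..}. principal {(x, y). dist x y < e})"

definition open_disc_algebra :: "disc_algebra set \<Rightarrow> bool" where
  "open_disc_algebra U \<longleftrightarrow> (\<forall>x\<in>U. eventually (\<lambda>(x', y). x' = x \<longrightarrow> y \<in> U) uniformity)"

lemma cmod_disc_fun_le_norm: "cmod (disc_fun f z) \<le> norm f"
proof (cases "z \<in> cball 0 1")
  case True
  then show ?thesis
    unfolding norm_disc_algebra_def by (rule cSUP_upper[OF _ bdd_above_disc_fun])
next
  case False
  have "0 \<le> cmod (disc_fun f 0)" by simp
  also have "\<dots> \<le> norm f"
    unfolding norm_disc_algebra_def by (rule cSUP_upper[OF _ bdd_above_disc_fun]) auto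
  finally show ?thesis using False by (simp add: disc_fun_outside)
qed

lemma norm_disc_algebra_leI:
  assumes "\<And>z. z \<in> cball 0 1 \<Longrightarrow> cmod (disc_fun f z) \<le> C"
  shows "norm f \<le> C"
proof -
  have "(0::complex) \<in> cball 0 1" by simp
  then have "cball (0::complex) 1 \<noteq> {}" by blast
  then show ?thesis unfolding norm_disc_algebra_def using assms by (rule cSUP_least)
qed

lemma norm_scale_disc_algebra:
  assumes "\<And>z. disc_fun g z = c * disc_fun f z"
  shows "norm g = cmod c * norm f"
proof (rule antisym)
  show "norm g \<le> cmod c * norm f"
    by (rule norm_disc_algebra_leI)
      (simp add: assms norm_mult mult_left_mono cmod_disc_fun_le_norm)
  show "cmod c * norm f \<le> norm g"
  proof (cases "c = 0")
    case True
    have "0 \<le> norm g" using norm_ge_zero cmod_disc_fun_le_norm by (rule order_trans)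
    then show ?thesis using True by simp
  next
    case False
    have "norm f \<le> norm g / cmod c"
    proof (rule norm_disc_algebra_leI)
      fix z
      show "cmod (disc_fun f z) \<le> norm g / cmod c"
        using cmod_disc_fun_le_norm[of g z] False
        by (simp add: assms norm_mult pos_le_divide_eq mult.commute)
    qed
    then show ?thesis using False by (simp add: pos_le_divide_eq mult.commute)
  qed
qed

instance
proof
  fix f g h :: disc_algebra and a b :: real
  note [simp] = zero_disc_algebra.rep_eq one_disc_algebra.rep_eq plus_disc_algebra.rep_eq
    minus_disc_algebra.rep_eq uminus_disc_algebra.rep_eq times_disc_algebra.rep_eq
    scaleR_disc_algebra.rep_eq
  show "f + g + h = f + (g + h)" "f + g = g + f" "0 + f = f" "- f + f = 0" "f - g = f + - g"
    "f * g * h = f * (g * h)" "(f + g) * h = f * h + g * h" "f * (g + h) = f * g + f * h"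
    "f * g = g * f" "1 * f = f" "f * 1 = f"
    "a *\<^sub>R (f + g) = a *\<^sub>R f + a *\<^sub>R g" "(a + b) *\<^sub>R f = a *\<^sub>R f + b *\<^sub>R f"
    "a *\<^sub>R b *\<^sub>R f = (a * b) *\<^sub>R f" "1 *\<^sub>R f = f"
    "a *\<^sub>R f * g = a *\<^sub>R (f * g)" "f * a *\<^sub>R g = a *\<^sub>R (f * g)"
    by (rule disc_algebra_eqI; simp add: algebra_simps)+
  show "(0::disc_algebra) \<noteq> 1"
  proof
    assume "(0::disc_algebra) = 1"
    then have "disc_fun 0 0 = disc_fun 1 0" by simp
    then show False by simp
  qed
  show "dist f g = norm (f - g)" by (fact dist_disc_algebra_def)
  show "sgn f = inverse (norm f) *\<^sub>R f" by (fact sgn_disc_algebra_def)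
  show "(uniformity :: (disc_algebra \<times> disc_algebra) filter) =
      (INF e\<in>{0<..}. principal {(x, y). dist x y < e})"
    by (fact uniformity_disc_algebra_def)
  show "open U \<longleftrightarrow> (\<forall>x\<in>U. eventually (\<lambda>(x', y). x' = x \<longrightarrow> y \<in> U) uniformity)"
    for U :: "disc_algebra set"
    by (fact open_disc_algebra_def)
  have nonneg: "0 \<le> norm f" for f :: disc_algebra
    using norm_ge_zero cmod_disc_fun_le_norm by (rule order_trans)
  show "norm f = 0 \<longleftrightarrow> f = 0"
  proof
    assume "norm f = 0"
    then have "cmod (disc_fun f z) \<le> 0" for z using cmod_disc_fun_le_norm[of f z] by simp
    then show "f = 0" by (intro disc_algebra_eqI) simp
  next
    assume "f = 0"
    then have "norm f \<le> 0" by (intro norm_disc_algebra_leI) simp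
    then show "norm f = 0" using nonneg[of f] by simp
  qed
  show "norm (f + g) \<le> norm f + norm g"
    by (rule norm_disc_algebra_leI)
      (auto intro: norm_triangle_le add_mono cmod_disc_fun_le_norm)
  show "norm (a *\<^sub>R f) = \<bar>a\<bar> * norm f"
    using norm_scale_disc_algebra[of "a *\<^sub>R f" "complex_of_real a" f] by simp
  show "norm (f * g) \<le> norm f * norm g"
    by (rule norm_disc_algebra_leI)
      (auto simp: norm_mult intro!: mult_mono cmod_disc_fun_le_norm nonneg)
  show "norm (1::disc_algebra) = 1"
  proof (rule antisym)
    show "norm (1::disc_algebra) \<le> 1" by (rule norm_disc_algebra_leI) simp
    show "1 \<le> norm (1::disc_algebra)" using cmod_disc_fun_le_norm[of 1 0] by simp
  qed
qed

end

lemma complete_disc_algebra: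
  fixes X :: "nat \<Rightarrow> disc_algebra"
  assumes "Cauchy X"
  shows "convergent X"
proof -
  have diff: "dist (disc_fun f z) (disc_fun g z) \<le> dist f g" for f g z
    using cmod_disc_fun_le_norm[of "f - g" z]
    by (simp add: dist_norm minus_disc_algebra.rep_eq)
  have "uniformly_Cauchy_on UNIV (\<lambda>n. disc_fun (X n))"
    unfolding uniformly_Cauchy_on_def
  proof (intro allI impI)
    fix e :: real assume "e > 0"
    then obtain M where M: "\<forall>m\<ge>M. \<forall>n\<ge>M. dist (X m) (X n) < e"
      using \<open>Cauchy X\<close> unfolding Cauchy_def by blast
    show "\<exists>M. \<forall>x\<in>UNIV. \<forall>m\<ge>M. \<forall>n\<ge>M. dist (disc_fun (X m) x) (disc_fun (X n) x) < e"
    proof (intro exI ballI allI impI)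
      fix z m n assume "m \<ge> M" "n \<ge> M"
      then have "dist (X m) (X n) < e" using M by blast
      with diff show "dist (disc_fun (X m) z) (disc_fun (X n) z) < e"
        by (rule le_less_trans)
    qed
  qed
  then obtain l where l: "uniform_limit UNIV (\<lambda>n. disc_fun (X n)) l sequentially"
    using Cauchy_uniformly_convergent[of UNIV "\<lambda>n. disc_fun (X n)"]
    unfolding uniformly_convergent_on_def by blast
  have cont: "continuous_on (cball 0 1) l"
    by (rule uniform_limit_theorem[OF _ uniform_limit_on_subset[OF l]])
      (simp_all add: continuous_disc_fun)
  have "l holomorphic_on ball 0 1"
    using holomorphic_uniform_limit[of 0 1 "\<lambda>n. disc_fun (X n)" sequentially l]
      uniform_limit_on_subset[OF l, of "cball 0 1"] continuous_disc_fun holomorphic_disc_fun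
    by auto
  moreover have "l z = 0" if "z \<notin> cball 0 1" for z
  proof (rule LIMSEQ_unique)
    show "(\<lambda>n. disc_fun (X n) z) \<longlonglongrightarrow> l z"
      using tendsto_uniform_limitI[OF l, of z] by simp
    show "(\<lambda>n. disc_fun (X n) z) \<longlonglongrightarrow> 0" using that by (simp add: disc_fun_outside)
  qed
  ultimately obtain L where L: "disc_fun L = l"
    using cont Abs_disc_algebra_inverse[of l] by auto
  have "X \<longlonglongrightarrow> L"
  proof (rule metric_LIMSEQ_I)
    fix e :: real assume "e > 0"
    then have "\<forall>\<^sub>F n in sequentially. \<forall>z\<in>UNIV. dist (disc_fun (X n) z) (l z) < e / 2"
      using l unfolding uniform_limit_iff by (meson half_gt_zero)
    then obtain N where N: "\<And>n z. n \<ge> N \<Longrightarrow> dist (disc_fun (X n) z) (l z) < e / 2"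
      unfolding eventually_sequentially by blast
    have "dist (X n) L < e" if "n \<ge> N" for n
    proof -
      have "norm (X n - L) \<le> e / 2"
      proof (rule norm_disc_algebra_leI)
        fix z
        show "cmod (disc_fun (X n - L) z) \<le> e / 2"
          using N[OF that, of z] by (simp add: minus_disc_algebra.rep_eq L dist_norm)
      qed
      then show ?thesis using \<open>e > 0\<close> by (simp add: dist_norm)
    qed
    then show "\<exists>N. \<forall>n\<ge>N. dist (X n) L < e" by blast
  qed
  then show ?thesis by (rule convergentI)
qed

instantiation disc_algebra :: complex_banach_algebra
begin

lift_definition scaleC_disc_algebra :: "complex \<Rightarrow> disc_algebra \<Rightarrow> disc_algebra"
  is "\<lambda>c f z. c * f z" by (auto intro!: continuous_intros holomorphic_intros)

instance
proof
  fix f g :: disc_algebra and a b :: complex and r :: real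
  note [simp] = plus_disc_algebra.rep_eq times_disc_algebra.rep_eq scaleR_disc_algebra.rep_eq
    scaleC_disc_algebra.rep_eq
  show "a *\<^sub>C (f + g) = a *\<^sub>C f + a *\<^sub>C g" "(a + b) *\<^sub>C f = a *\<^sub>C f + b *\<^sub>C f"
    "a *\<^sub>C b *\<^sub>C f = (a * b) *\<^sub>C f" "complex_of_real r *\<^sub>C f = r *\<^sub>R f"
    "a *\<^sub>C f * g = a *\<^sub>C (f * g)" "f * a *\<^sub>C g = a *\<^sub>C (f * g)"
    by (rule disc_algebra_eqI; simp add: algebra_simps)+
  show "norm (a *\<^sub>C f) = cmod a * norm f"
    by (rule norm_scale_disc_algebra) simp
  show "convergent X" if "Cauchy X" for X :: "nat \<Rightarrow> disc_algebra"
    using that by (rule complete_disc_algebra)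
qed

end

end

theory Submission imports Defs begin

text \<open>Write \<open>D\<close> for the open disc, \<open>\<T>\<close> for the unit circle, and \<open>e\<close> for the identity function
  of the closed disc.

  The engine is a statement about an arbitrary, not necessarily surjective, linear isometry \<open>T\<close>
  of the disc algebra (\<open>isometry_weighted_evaluation\<close>): each point \<open>w\<close> of \<open>\<T>\<close> is seen by \<open>T\<close>
  at some point \<open>z\<close> of \<open>\<T>\<close>, in the sense that \<open>(T f)(z) = f(w) (T 1)(z)\<close> for all \<open>f\<close>, with
  \<open>\<bar>(T 1)(z)\<bar> = 1\<close>. It holds because \<open>w\<close> is a peak point.

  For a surjective isometry \<open>L\<close> the same applies to the inverse of \<open>L\<close>, and it gives such a \<open>w\<close>
  for every given \<open>z\<close>. So \<open>L (f g) \<cdot> L 1 = L f \<cdot> L g\<close> on \<open>\<T>\<close>, hence everywhere, which makes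
  \<open>L 1\<close> invertible in the algebra; having modulus one on \<open>\<T>\<close> it is a constant \<open>c\<close>. Therefore
  \<open>L f = c \<cdot> (f \<circ> \<phi>)\<close> with \<open>\<phi> = L e / c\<close>, and \<open>\<phi>\<close> is a homeomorphism of the closed disc
  that preserves \<open>\<T>\<close>.

  Now let \<open>T\<close> lie in the reflexive closure of the isometry group. Then \<open>T\<close> is isometric, and
  \<open>T 1\<close> is a unimodular constant \<open>c\<close> as a limit of such constants. The function \<open>T e\<close> is a uniform
  limit of injective maps of the closed disc onto itself. By compactness such a limit is still onto,
  so it is not constant, and Hurwitz's theorem keeps it injective on \<open>D\<close>. By the Schwarz lemma a
  bijective holomorphic self-map of \<open>D\<close> is a Moebius map, so \<open>T e\<close> has a left inverse that is
  continuous up to the boundary. The evaluation statement applied to \<open>T\<close> itself now gives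
  \<open>T f = c \<cdot> (f \<circ> (T e / c))\<close> on \<open>\<T>\<close>, and any \<open>h\<close> is attained by composing it with the left
  inverse. So \<open>T\<close> is surjective.

  Automorphisms are isometric, because \<open>f - \<lambda>\<close> is invertible whenever \<open>\<bar>\<lambda>\<bar> > \<parallel>f\<parallel>\<close>. So an
  operator in the reflexive closure of the automorphism group is a surjective isometry by the above;
  it fixes \<open>1\<close>, and then \<open>L (f g) \<cdot> L 1 = L f \<cdot> L g\<close> says that it is multiplicative.\<close>


section \<open>Evaluation and construction of elements of the disc algebra\<close>

lemmas disc_fun_simps =
  zero_disc_algebra.rep_eq one_disc_algebra.rep_eq plus_disc_algebra.rep_eq
  minus_disc_algebra.rep_eq uminus_disc_algebra.rep_eq times_disc_algebra.rep_eq
  scaleC_disc_algebra.rep_eq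

lemma disc_fun_power: "cmod z \<le> 1 \<Longrightarrow> disc_fun (f ^ n) z = disc_fun f z ^ n"
  by (induction n) (simp_all add: disc_fun_simps)

definition disc_of :: "(complex \<Rightarrow> complex) \<Rightarrow> disc_algebra" where
  "disc_of f = Abs_disc_algebra (\<lambda>z. if z \<in> cball 0 1 then f z else 0)"

lemma disc_fun_disc_of:
  assumes "continuous_on (cball 0 1) f" "f holomorphic_on ball 0 1" "cmod z \<le> 1"
  shows "disc_fun (disc_of f) z = f z"
proof -
  have "continuous_on (cball 0 1) (\<lambda>z. if z \<in> cball 0 1 then f z else 0)"
    by (rule continuous_on_eq[OF assms(1)]) auto
  moreover have "(\<lambda>z. if z \<in> cball 0 1 then f z else 0) holomorphic_on ball 0 1"
    by (rule holomorphic_transform[OF assms(2)]) auto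
  ultimately show ?thesis
    using assms(3) unfolding disc_of_def by (subst Abs_disc_algebra_inverse) auto
qed

definition disc_id :: disc_algebra where
  "disc_id = disc_of (\<lambda>z. z)"

lemma disc_fun_disc_id [simp]: "cmod z \<le> 1 \<Longrightarrow> disc_fun disc_id z = z"
  unfolding disc_id_def by (rule disc_fun_disc_of) (auto intro: holomorphic_intros)

lemma disc_fun_disc_of_compose:
  assumes "continuous_on (cball 0 1) h" "h holomorphic_on ball 0 1"
    and "h ` cball 0 1 \<subseteq> cball 0 1" "h ` ball 0 1 \<subseteq> ball 0 1" "cmod z \<le> 1"
  shows "disc_fun (disc_of (\<lambda>z. disc_fun f (h z))) z = disc_fun f (h z)"
proof (rule disc_fun_disc_of)
  show "continuous_on (cball 0 1) (\<lambda>z. disc_fun f (h z))"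
    by (rule continuous_on_compose2[OF continuous_disc_fun assms(1,3)])
  show "(\<lambda>z. disc_fun f (h z)) holomorphic_on ball 0 1"
    using holomorphic_on_compose_gen[OF assms(2) holomorphic_disc_fun assms(4)]
    by (simp add: o_def)
qed (fact assms(5))

lemma norm_attained_on_circle:
  obtains z where "cmod z = 1" "cmod (disc_fun f z) = norm f"
proof -
  have "continuous_on (sphere 0 1) (\<lambda>z. cmod (disc_fun f z))"
    by (intro continuous_on_norm continuous_on_subset[OF continuous_disc_fun]) auto
  moreover have "(1::complex) \<in> sphere 0 1" by simp
  ultimately obtain z where z: "z \<in> sphere 0 1"
    and max: "\<And>y. y \<in> sphere 0 1 \<Longrightarrow> cmod (disc_fun f y) \<le> cmod (disc_fun f z)"
    using continuous_attains_sup[OF compact_sphere, of 0 1 "\<lambda>z. cmod (disc_fun f z)"] by blast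
  have "norm f \<le> cmod (disc_fun f z)"
  proof (rule norm_disc_algebra_leI)
    fix y :: complex assume "y \<in> cball 0 1"
    then show "cmod (disc_fun f y) \<le> cmod (disc_fun f z)"
      using maximum_modulus_frontier[of "disc_fun f" "cball 0 1" "cmod (disc_fun f z)" y]
        continuous_disc_fun[of f] holomorphic_disc_fun[of f] max by simp
  qed
  with cmod_disc_fun_le_norm[of f z] z that show ?thesis by simp
qed

lemma eq_if_eq_on_circle:
  assumes "\<And>z. cmod z = 1 \<Longrightarrow> disc_fun f z = disc_fun g z"
  shows "f = g"
proof -
  obtain z where "cmod z = 1" "cmod (disc_fun (f - g) z) = norm (f - g)"
    by (rule norm_attained_on_circle)
  with assms[of z] have "norm (f - g) = 0" by (simp add: disc_fun_simps)
  then show ?thesis by simp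
qed

text \<open>The maximum modulus principle makes \<open>g\<close> constant on the open disc; continuity extends this to the
  boundary. Contrapositively, a non-constant self-map of the closed disc in the algebra sends no
  interior point to the circle.\<close>

lemma const_if_max_inside:
  assumes "norm g \<le> 1" "cmod y < 1" "cmod (disc_fun g y) = 1" "cmod z \<le> 1"
  shows "disc_fun g z = disc_fun g y"
proof -
  have "disc_fun g constant_on ball 0 1"
  proof (rule maximum_modulus_principle[OF holomorphic_disc_fun _ _ _ order_refl, of y])
    fix z show "cmod (disc_fun g z) \<le> cmod (disc_fun g y)"
      using cmod_disc_fun_le_norm[of g z] assms by simp
  qed (use assms in auto)
  then have "disc_fun g constant_on closure (ball 0 1)"
    by (rule constant_on_closureI) (simp add: continuous_disc_fun)
  then show ?thesis using assms unfolding constant_on_def by force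
qed

lemma invertible_if_nonvanishing:
  assumes "\<And>z. cmod z \<le> 1 \<Longrightarrow> disc_fun f z \<noteq> 0"
  obtains g where "f * g = 1"
proof -
  have "disc_fun (disc_of (\<lambda>z. inverse (disc_fun f z))) z = inverse (disc_fun f z)"
    if "cmod z \<le> 1" for z
    using assms that
    by (intro disc_fun_disc_of continuous_on_inverse holomorphic_on_inverse
        continuous_disc_fun holomorphic_disc_fun) auto
  with assms have "f * disc_of (\<lambda>z. inverse (disc_fun f z)) = 1"
    by (intro disc_algebra_eqI) (simp add: disc_fun_simps)
  then show ?thesis by (rule that)
qed


section \<open>Points seen by a linear isometry\<close>

text \<open>This function equals 1 at the point \<open>w\<close> of the unit circle and has modulus less than 1 at all
  other points of the closed disc, so its powers concentrate at \<open>w\<close>.\<close>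

definition peak :: "complex \<Rightarrow> disc_algebra" where
  "peak w = (1/2) *\<^sub>C (1 + cnj w *\<^sub>C disc_id)"

lemma disc_fun_peak: "cmod z \<le> 1 \<Longrightarrow> disc_fun (peak w) z = (1 + cnj w * z) / 2"
  by (simp add: peak_def disc_fun_simps)

lemma peak_at:
  assumes "cmod w = 1" shows "disc_fun (peak w) w = 1"
  using assms complex_norm_square[of w] by (simp add: disc_fun_peak mult.commute)

lemma peak_le_1:
  assumes "cmod w = 1" "cmod z \<le> 1" shows "cmod (disc_fun (peak w) z) \<le> 1"
  using norm_triangle_ineq[of 1 "cnj w * z"] assms
  by (simp add: disc_fun_peak norm_mult norm_divide)

lemma peak_less_1:
  assumes "cmod w = 1" "cmod z \<le> 1" "z \<noteq> w" shows "cmod (disc_fun (peak w) z) < 1"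
proof (rule ccontr)
  define a where "a = cnj w * z"
  assume "\<not> cmod (disc_fun (peak w) z) < 1"
  then have "2 \<le> cmod (1 + a)" using assms by (simp add: disc_fun_peak a_def norm_divide)
  then have "4 \<le> (cmod (1 + a))\<^sup>2" using power_mono[of 2 "cmod (1 + a)" 2] by simp
  moreover have "(cmod a)\<^sup>2 \<le> 1" using assms by (simp add: a_def norm_mult power_le_one)
  moreover have "(cmod (1 + a))\<^sup>2 = 1 + 2 * Re a + (cmod a)\<^sup>2"
    unfolding cmod_power2 by (simp add: power2_eq_square algebra_simps)
  ultimately have "Re a \<ge> 1" "(Re a)\<^sup>2 + (Im a)\<^sup>2 \<le> 1"
    by (linarith, simp add: cmod_power2)
  moreover from this have "(Re a)\<^sup>2 \<ge> 1" by (simp add: one_le_power)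
  ultimately have "(Im a)\<^sup>2 \<le> 0" "(Re a)\<^sup>2 = 1" "Re a \<ge> 1"
    using zero_le_power2[of "Im a"] by linarith+
  then have "a = 1" by (simp add: complex_eq_iff power2_eq_1_iff)
  moreover have "w * cnj w = 1" using assms complex_norm_square[of w] by simp
  ultimately have "z = w" unfolding a_def
    by (metis mult.assoc mult.commute mult.right_neutral)
  with assms show False by simp
qed

text \<open>Where \<open>f\<close> is not small the power of the peak function is, and near \<open>w\<close> the opposite happens. So
  adding \<open>f\<close>, with any phase, to \<open>\<parallel>f\<parallel>\<close> times that power hardly raises the norm above \<open>\<parallel>f\<parallel>\<close>.\<close>

lemma norm_peak_power_add_le:
  assumes w: "cmod w = 1" and f: "disc_fun f w = 0" and e: "e > 0"
  shows "\<forall>\<^sub>F n in sequentially. \<forall>u. cmod u = 1 \<longrightarrow>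
    norm (complex_of_real (norm f) *\<^sub>C peak w ^ n + u *\<^sub>C f) \<le> norm f + e"
proof -
  have "w \<in> cball 0 1" using w by simp
  with continuous_disc_fun[of f] e obtain d where d: "d > 0"
    "\<And>z. z \<in> cball 0 1 \<Longrightarrow> dist z w < d \<Longrightarrow> dist (disc_fun f z) (disc_fun f w) < e"
    unfolding continuous_on_iff by blast
  define K where "K = cball 0 1 - ball w d"
  have K: "compact K" unfolding K_def by (intro compact_diff) auto
  obtain r where r: "0 \<le> r" "r < 1" "\<And>z. z \<in> K \<Longrightarrow> cmod (disc_fun (peak w) z) \<le> r"
  proof (cases "K = {}")
    case True then show ?thesis using that[of 0] by simp
  next
    case False
    have "continuous_on K (\<lambda>z. cmod (disc_fun (peak w) z))"
      by (intro continuous_on_norm continuous_on_subset[OF continuous_disc_fun])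
        (auto simp: K_def)
    from continuous_attains_sup[OF K False this] obtain y where y: "y \<in> K"
      "\<And>z. z \<in> K \<Longrightarrow> cmod (disc_fun (peak w) z) \<le> cmod (disc_fun (peak w) y)" by blast
    from y(1) have "cmod y \<le> 1" "y \<noteq> w" using d(1) by (auto simp: K_def)
    from that[OF norm_ge_zero peak_less_1[OF w this] y(2)] show ?thesis .
  qed
  have "(\<lambda>n. norm f * r ^ n) \<longlonglongrightarrow> norm f * 0"
    using r by (intro tendsto_mult tendsto_const LIMSEQ_power_zero) simp
  then have "\<forall>\<^sub>F n in sequentially. norm f * r ^ n < e"
    using e by (auto dest: order_tendstoD(2))
  then show ?thesis
  proof eventually_elim
    case (elim n)
    show ?case
    proof (intro allI impI norm_disc_algebra_leI)
      fix u z :: complex assume u: "cmod u = 1" and z: "z \<in> cball 0 1"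
      have "cmod (disc_fun (complex_of_real (norm f) *\<^sub>C peak w ^ n + u *\<^sub>C f) z)
        \<le> norm f * cmod (disc_fun (peak w) z) ^ n + cmod (disc_fun f z)"
        using z u norm_triangle_ineq
          [of "complex_of_real (norm f) * disc_fun (peak w) z ^ n" "u * disc_fun f z"]
        by (simp add: disc_fun_simps disc_fun_power norm_mult norm_power)
      also have "\<dots> \<le> norm f + e"
      proof (cases "z \<in> K")
        case True
        then have "norm f * cmod (disc_fun (peak w) z) ^ n \<le> norm f * r ^ n"
          using r by (intro mult_left_mono power_mono) auto
        then show ?thesis using elim cmod_disc_fun_le_norm[of f z] by simp
      next
        case False
        then have "cmod (disc_fun f z) \<le> e"
          using z d(2)[of z] f by (auto simp: K_def dist_commute)
        moreover have "norm f * cmod (disc_fun (peak w) z) ^ n \<le> norm f * 1"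
          using peak_le_1[OF w, of z] z by (intro mult_left_mono power_le_one) auto
        ultimately show ?thesis by simp
      qed
      finally show "cmod (disc_fun (complex_of_real (norm f) *\<^sub>C peak w ^ n + u *\<^sub>C f) z)
        \<le> norm f + e" .
    qed
  qed
qed

lemma exists_aligning_phase:
  obtains u :: complex where "cmod u = 1" "cmod (a + u * b) = cmod a + cmod b"
proof (cases "a = 0 \<or> b = 0")
  case True then show ?thesis using that[of 1] by auto
next
  case False
  define u where "u = (a / of_real (cmod a)) * (of_real (cmod b) / b)"
  have "a + u * b = (a / of_real (cmod a)) * of_real (cmod a + cmod b)"
    using False by (simp add: u_def field_simps)
  then have "cmod (a + u * b) = cmod (a / of_real (cmod a)) * cmod (of_real (cmod a + cmod b))"
    by (simp only: norm_mult)
  then have "cmod (a + u * b) = cmod a + cmod b"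
    using False by (simp add: norm_divide del: of_real_add)
  moreover have "cmod u = 1" using False by (simp add: u_def norm_mult norm_divide)
  ultimately show ?thesis using that by blast
qed

lemma
  assumes "T \<in> bounded_operators"
  shows bounded_operators_add: "T (f + g) = T f + T g"
    and bounded_operators_diff: "T (f - g) = T f - T g"
    and bounded_operators_scaleC: "T (c *\<^sub>C f) = c *\<^sub>C T f"
  using assms unfolding bounded_operators_def
  by (simp_all add: linear_add[OF bounded_linear.linear] linear_diff[OF bounded_linear.linear])

text \<open>At a point where \<open>1 + p\<^sup>n\<close>, with \<open>p\<close> the peak function at \<open>w\<close>, has an image of
  maximal modulus 2, the images of \<open>1\<close> and of \<open>p\<^sup>n\<close> both have modulus 1. If \<open>f(w) = 0\<close>, then
  \<open>\<parallel>f\<parallel> p\<^sup>n + u f\<close> has norm close to \<open>\<parallel>f\<parallel>\<close> for every phase \<open>u\<close>, while \<open>T\<close> maps the first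
  summand to something of modulus \<open>\<parallel>f\<parallel>\<close> at that point. This leaves no room for \<open>T f\<close> there. An
  accumulation point \<open>z\<close> of these maximum points does not depend on \<open>f\<close>; so \<open>f(w) = 0\<close> implies
  \<open>(T f)(z) = 0\<close> for all \<open>f\<close> at once, and subtracting constants gives the formula.\<close>

lemma isometry_weighted_evaluation:
  assumes T: "T \<in> bounded_operators" and iso: "\<And>f. norm (T f) = norm f" and w: "cmod w = 1"
  obtains z where "cmod z = 1" "cmod (disc_fun (T 1) z) = 1"
    "\<And>f. disc_fun (T f) z = disc_fun f w * disc_fun (T 1) z"
proof -
  have le: "cmod (disc_fun (T f) z) \<le> norm f" for f z
    using cmod_disc_fun_le_norm[of "T f" z] iso by simp
  have norm_h: "norm (peak w ^ n) \<le> 1" for n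
    by (rule norm_disc_algebra_leI)
      (simp add: disc_fun_power norm_power power_le_one peak_le_1[OF w])
  have "\<exists>z. cmod z = 1 \<and> cmod (disc_fun (T 1) z) = 1 \<and> cmod (disc_fun (T (peak w ^ n)) z) = 1"
    for n
  proof -
    obtain z where z: "cmod z = 1"
      "cmod (disc_fun (T (1 + peak w ^ n)) z) = norm (T (1 + peak w ^ n))"
      by (rule norm_attained_on_circle)
    have "2 \<le> norm (T (1 + peak w ^ n))"
      using cmod_disc_fun_le_norm[of "1 + peak w ^ n" w] w
      by (simp add: iso disc_fun_simps disc_fun_power peak_at)
    moreover have "cmod (disc_fun (T (1 + peak w ^ n)) z)
        \<le> cmod (disc_fun (T 1) z) + cmod (disc_fun (T (peak w ^ n)) z)"
      by (simp add: bounded_operators_add[OF T] disc_fun_simps norm_triangle_ineq)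
    moreover have "cmod (disc_fun (T 1) z) \<le> 1" "cmod (disc_fun (T (peak w ^ n)) z) \<le> 1"
      using le[of 1 z] le[of "peak w ^ n" z] norm_h[of n] by simp_all
    ultimately show ?thesis using z by (intro exI[of _ z]) linarith
  qed
  then obtain x where x: "\<And>n. cmod (x n) = 1" "\<And>n. cmod (disc_fun (T 1) (x n)) = 1"
    "\<And>n. cmod (disc_fun (T (peak w ^ n)) (x n)) = 1" by metis
  have "compact (sphere (0::complex) 1)" by simp
  then obtain z r where z: "z \<in> sphere 0 1" and r: "strict_mono r" "(x \<circ> r) \<longlonglongrightarrow> z"
    using x(1) by (auto simp: compact_def dest!: spec[of _ x])
  have lim: "(\<lambda>n. cmod (disc_fun g (x (r n)))) \<longlonglongrightarrow> cmod (disc_fun g z)" for g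
    using continuous_on_tendsto_compose[OF continuous_disc_fun, of "x \<circ> r" z sequentially g]
      r(2) z x(1)
    by (intro tendsto_norm) (simp add: o_def)
  have T1: "cmod (disc_fun (T 1) z) = 1"
    using lim[of "T 1"] by (simp add: x(2) LIMSEQ_const_iff)
  have vanish: "disc_fun (T f) z = 0" if f: "disc_fun f w = 0" for f
  proof -
    have "(\<lambda>n. cmod (disc_fun (T f) (x (r n)))) \<longlonglongrightarrow> 0"
    proof (rule order_tendstoI)
      fix e :: real assume "e > 0"
      then have "\<forall>\<^sub>F n in sequentially. \<forall>u. cmod u = 1 \<longrightarrow>
        norm (complex_of_real (norm f) *\<^sub>C peak w ^ n + u *\<^sub>C f) \<le> norm f + e / 2"
        by (intro norm_peak_power_add_le w f) simp
      then have "\<forall>\<^sub>F n in sequentially. cmod (disc_fun (T f) (x n)) < e"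
      proof eventually_elim
        case (elim n)
        let ?a = "complex_of_real (norm f) * disc_fun (T (peak w ^ n)) (x n)"
        obtain u where u: "cmod u = 1"
          "cmod (?a + u * disc_fun (T f) (x n)) = cmod ?a + cmod (disc_fun (T f) (x n))"
          by (rule exists_aligning_phase)
        have "cmod (?a + u * disc_fun (T f) (x n)) =
          cmod (disc_fun (T (complex_of_real (norm f) *\<^sub>C peak w ^ n + u *\<^sub>C f)) (x n))"
          by (simp add: bounded_operators_add[OF T] bounded_operators_scaleC[OF T] disc_fun_simps)
        also have "\<dots> \<le> norm f + e / 2" using order_trans[OF le] elim u(1) by blast
        finally show ?case using u(2) x(3)[of n] \<open>e > 0\<close> by (simp add: norm_mult)
      qed
      then show "\<forall>\<^sub>F n in sequentially. cmod (disc_fun (T f) (x (r n))) < e"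
        by (rule eventually_subseq[OF r(1)])
    qed (simp add: order_less_le_trans[OF _ norm_ge_zero])
    from LIMSEQ_unique[OF this lim] show ?thesis by simp
  qed
  have "disc_fun (T f) z = disc_fun f w * disc_fun (T 1) z" for f
  proof -
    have "disc_fun (T (f - disc_fun f w *\<^sub>C 1)) z = 0"
      using w by (intro vanish) (simp add: disc_fun_simps)
    then show ?thesis
      by (simp add: bounded_operators_diff[OF T] bounded_operators_scaleC[OF T] disc_fun_simps)
  qed
  from that[OF _ T1 this] z show ?thesis by simp
qed


section \<open>Surjective isometries are weighted composition operators\<close>

lemma isometry_groupD:
  assumes "L \<in> isometry_group"
  shows "L \<in> bounded_operators" "surj L" "norm (L f) = norm f"
  using assms by (auto simp: isometry_group_def)

lemma inj_isometry:
  assumes "L \<in> bounded_operators" "\<And>f. norm (L f) = norm f"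
  shows "inj L"
proof (rule injI)
  fix f g assume "L f = L g"
  then have "norm (f - g) = 0"
    using assms(2)[of "f - g"] by (simp add: bounded_operators_diff[OF assms(1)])
  then show "f = g" by simp
qed

lemma inv_isometry_group:
  assumes L: "L \<in> isometry_group"
  shows "inv L \<in> isometry_group" "inv L (L f) = f" "L (inv L f) = f"
proof -
  note LD = isometry_groupD[OF L]
  have inj: "inj L" by (rule inj_isometry) (simp_all add: LD)
  show left: "inv L (L f) = f" for f using inj by simp
  show right: "L (inv L f) = f" for f using LD(2) by (simp add: surj_f_inv_f)
  have norm: "norm (inv L f) = norm f" for f using LD(3)[of "inv L f"] right by simp
  have scale: "inv L (c *\<^sub>C f) = c *\<^sub>C inv L f" for c f
    by (metis left right bounded_operators_scaleC[OF LD(1)])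
  have "bounded_linear (inv L)"
  proof (rule bounded_linear_intro[where K = 1])
    show "inv L (f + g) = inv L f + inv L g" for f g
      by (metis left right bounded_operators_add[OF LD(1)])
    show "inv L (r *\<^sub>R f) = r *\<^sub>R inv L f" for r f
      using scale[of "complex_of_real r" f] by (simp add: scaleC_of_real)
  qed (simp add: norm)
  moreover have "surj (inv L)" using left by (metis surjI)
  ultimately show "inv L \<in> isometry_group"
    using scale norm by (simp add: isometry_group_def bounded_operators_def)
qed

text \<open>For a general isometry the point \<open>w\<close> is given and \<open>z\<close> is found. Applying this to the inverse of
  \<open>L\<close> exchanges the two, so that here every \<open>z\<close> on the circle is covered.\<close>

lemma surjective_isometry_weighted_evaluation:
  assumes L: "L \<in> isometry_group" and z: "cmod z = 1"
  obtains w where "cmod w = 1" "cmod (disc_fun (L 1) z) = 1"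
    "\<And>f. disc_fun (L f) z = disc_fun f w * disc_fun (L 1) z"
proof -
  note inv = inv_isometry_group[OF L]
  note M = isometry_groupD[OF inv(1)]
  obtain w where w: "cmod w = 1" "cmod (disc_fun (inv L 1) w) = 1"
    "\<And>g. disc_fun (inv L g) w = disc_fun g z * disc_fun (inv L 1) w"
    using isometry_weighted_evaluation[OF M(1) M(3) z] by blast
  define a where "a = disc_fun (inv L 1) w"
  have eq: "disc_fun f w = disc_fun (L f) z * a" for f
    using w(3)[of "L f"] by (simp add: inv(2) a_def)
  have one: "disc_fun (L 1) z * a = 1" using eq[of 1] w(1) by (simp add: disc_fun_simps)
  have "cmod (disc_fun (L 1) z) * cmod a = 1" unfolding norm_mult[symmetric] one by simp
  then have "cmod (disc_fun (L 1) z) = 1" using w(2) by (simp add: a_def)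
  moreover have "disc_fun (L f) z = disc_fun f w * disc_fun (L 1) z" for f
  proof -
    have "disc_fun f w * disc_fun (L 1) z = disc_fun (L f) z * (disc_fun (L 1) z * a)"
      unfolding eq[of f] by (simp only: ac_simps)
    then show ?thesis by (simp add: one)
  qed
  ultimately show ?thesis using that w(1) by blast
qed

text \<open>On the circle \<open>L\<close> is evaluation times the weight \<open>L 1\<close>, and functions that agree on the circle
  are equal.\<close>

lemma surjective_isometry_mult:
  fixes L :: "disc_algebra \<Rightarrow> disc_algebra"
  assumes L: "L \<in> isometry_group"
  shows "L (f * g) * L 1 = L f * L g"
proof (rule eq_if_eq_on_circle)
  fix z :: complex assume "cmod z = 1"
  then obtain w where "\<And>f. disc_fun (L f) z = disc_fun f w * disc_fun (L 1) z"
    using surjective_isometry_weighted_evaluation[OF L] by blast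
  from this[of f] this[of g] this[of "f * g"]
  show "disc_fun (L (f * g) * L 1) z = disc_fun (L f * L g) z"
    unfolding times_disc_algebra.rep_eq by (simp only: ac_simps)
qed

text \<open>If \<open>L f = 1\<close>, then the previous lemma gives \<open>L (f\<^sup>2) \<cdot> L 1 = 1\<close>. Both factors have norm at
  most 1, so both have modulus exactly 1 at the origin, and the maximum principle makes \<open>L 1\<close>
  constant.\<close>

lemma surjective_isometry_one:
  fixes L :: "disc_algebra \<Rightarrow> disc_algebra"
  assumes L: "L \<in> isometry_group"
  obtains c where "cmod c = 1" "L 1 = c *\<^sub>C 1"
proof -
  note LD = isometry_groupD[OF L] and inv = inv_isometry_group[OF L]
  define f where "f = inv L 1"
  have norm_f: "norm f = 1" unfolding f_def using isometry_groupD(3)[OF inv(1), of 1] by simp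
  have unit: "L (f * f) * L 1 = 1"
    using surjective_isometry_mult[OF L, of f f] by (simp add: f_def inv(3))
  have "norm (f * f) \<le> 1" using norm_mult_ineq[of f f] norm_f by simp
  then have "cmod (disc_fun (L (f * f)) 0) \<le> 1"
    using cmod_disc_fun_le_norm[of "L (f * f)" 0] LD(3) by simp
  moreover have "cmod (disc_fun (L 1) 0) \<le> 1"
    using cmod_disc_fun_le_norm[of "L 1" 0] LD(3)[of 1] by simp
  moreover have "cmod (disc_fun (L (f * f)) 0) * cmod (disc_fun (L 1) 0) = 1"
    using arg_cong[OF unit, of "\<lambda>h. cmod (disc_fun h 0)"] by (simp add: disc_fun_simps norm_mult)
  ultimately have "cmod (disc_fun (L 1) 0) = 1"
    using mult_right_mono[of "cmod (disc_fun (L (f * f)) 0)" 1 "cmod (disc_fun (L 1) 0)"] by simp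
  moreover from this have "L 1 = disc_fun (L 1) 0 *\<^sub>C 1"
  proof (intro disc_algebra_eqI)
    fix z :: complex assume "z \<in> cball 0 1"
    then show "disc_fun (L 1) z = disc_fun (disc_fun (L 1) 0 *\<^sub>C 1) z"
      using const_if_max_inside[of "L 1" 0 z] LD(3)[of 1] \<open>cmod (disc_fun (L 1) 0) = 1\<close>
      by (simp add: disc_fun_simps)
  qed
  ultimately show ?thesis by (rule that)
qed

text \<open>The formula holds on the circle by evaluating \<open>L\<close> at the identity function to identify the point
  seen from \<open>z\<close>. To extend it inwards, \<open>f \<circ> \<phi>\<close> must lie in the disc algebra, so \<open>\<phi>\<close> must map the
  open disc into itself; otherwise \<open>\<phi>\<close> would be constant and \<open>L\<close> would send the identity function
  to a constant, although constants already come from constants.\<close>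

lemma surjective_isometry_composition:
  assumes L: "L \<in> isometry_group"
  obtains c \<phi> where "cmod c = 1" "\<phi> = cnj c *\<^sub>C L disc_id" "norm \<phi> \<le> 1"
    "\<And>z. cmod z = 1 \<Longrightarrow> cmod (disc_fun \<phi> z) = 1"
    "\<And>f z. cmod z \<le> 1 \<Longrightarrow> disc_fun (L f) z = c * disc_fun f (disc_fun \<phi> z)"
proof -
  note LD = isometry_groupD[OF L]
  obtain c where c: "cmod c = 1" "L 1 = c *\<^sub>C 1" by (rule surjective_isometry_one[OF L])
  have cc: "cnj c * c = 1" "c * cnj c = 1" using complex_norm_square[of c] c by (simp_all add: mult.commute)
  define \<phi> where "\<phi> = cnj c *\<^sub>C L disc_id"
  have "norm disc_id \<le> 1" by (rule norm_disc_algebra_leI) simp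
  then have norm: "norm \<phi> \<le> 1" using c by (simp add: \<phi>_def norm_scaleC LD(3))
  have circle: "cmod (disc_fun \<phi> z) = 1 \<and> disc_fun (L f) z = c * disc_fun f (disc_fun \<phi> z)"
    if z: "cmod z = 1" for z f
  proof -
    obtain w where w: "cmod w = 1" "\<And>f. disc_fun (L f) z = disc_fun f w * disc_fun (L 1) z"
      using surjective_isometry_weighted_evaluation[OF L z] by blast
    have "disc_fun \<phi> z = w"
      using w(1) w(2)[of disc_id] z cc by (simp add: \<phi>_def c(2) disc_fun_simps)
    then show ?thesis using w(1) w(2)[of f] z by (simp add: c(2) disc_fun_simps)
  qed
  have le: "cmod (disc_fun \<phi> z) \<le> 1" for z
    using cmod_disc_fun_le_norm[of \<phi> z] norm by simp
  have inside: "cmod (disc_fun \<phi> z) < 1" if z: "cmod z < 1" for z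
  proof (rule ccontr)
    assume "\<not> cmod (disc_fun \<phi> z) < 1"
    with le[of z] have "cmod (disc_fun \<phi> z) = 1" by simp
    define v where "v = disc_fun \<phi> z"
    have const: "disc_fun \<phi> y = v" if "cmod y \<le> 1" for y
      unfolding v_def by (rule const_if_max_inside) fact+
    have "disc_fun (L disc_id) y = c * disc_fun \<phi> y" for y
      using cc by (simp add: \<phi>_def disc_fun_simps mult.assoc[symmetric])
    then have "L disc_id = L (v *\<^sub>C 1)"
      by (intro disc_algebra_eqI)
        (simp add: bounded_operators_scaleC[OF LD(1)] c(2) disc_fun_simps const)
    then have eq: "disc_id = v *\<^sub>C 1"
      using inj_isometry[OF LD(1,3)] by (simp add: inj_eq)
    have "disc_fun (v *\<^sub>C 1) 0 = 0" "disc_fun (v *\<^sub>C 1) 1 = 1" by (simp_all flip: eq)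
    then show False by (simp add: disc_fun_simps)
  qed
  have "disc_fun (L f) z = c * disc_fun f (disc_fun \<phi> z)" if z: "cmod z \<le> 1" for f z
  proof -
    define h where "h = disc_of (\<lambda>z. disc_fun f (disc_fun \<phi> z))"
    have h: "disc_fun h y = disc_fun f (disc_fun \<phi> y)" if "cmod y \<le> 1" for y
      unfolding h_def using le inside that
      by (intro disc_fun_disc_of_compose continuous_disc_fun holomorphic_disc_fun) auto
    have "L f = c *\<^sub>C h"
      by (rule eq_if_eq_on_circle) (simp add: circle h disc_fun_simps)
    then show ?thesis using h z by (simp add: disc_fun_simps)
  qed
  with c(1) \<phi>_def norm circle that show ?thesis by blast
qed

text \<open>The image of the identity function under \<open>L\<close> is, up to a rotation, the map \<open>\<phi>\<close> with
  \<open>L f = c \<cdot> (f \<circ> \<phi>)\<close>. It is injective because the identity function is in the range of \<open>L\<close>, and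
  onto because the inverse of \<open>L\<close> has the same form.\<close>

lemma surjective_isometry_disc_id:
  assumes L: "L \<in> isometry_group"
  shows "inj_on (disc_fun (L disc_id)) (cball 0 1)"
    and "cball 0 1 \<subseteq> disc_fun (L disc_id) ` cball 0 1"
    and "cmod z = 1 \<Longrightarrow> cmod (disc_fun (L disc_id) z) = 1"
proof -
  note inv = inv_isometry_group[OF L]
  show "inj_on (disc_fun (L disc_id)) (cball 0 1)"
  proof (rule inj_onI)
    fix x y :: complex
    assume xy: "x \<in> cball 0 1" "y \<in> cball 0 1" "disc_fun (L disc_id) x = disc_fun (L disc_id) y"
    obtain c \<phi> where \<phi>: "\<phi> = cnj c *\<^sub>C L disc_id"
      "\<And>f z. cmod z \<le> 1 \<Longrightarrow> disc_fun (L f) z = c * disc_fun f (disc_fun \<phi> z)"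
      using surjective_isometry_composition[OF L] by metis
    have "disc_fun \<phi> x = disc_fun \<phi> y" using xy(3) by (simp add: \<phi>(1) disc_fun_simps)
    then have "disc_fun (L (inv L disc_id)) x = disc_fun (L (inv L disc_id)) y"
      using xy(1,2) by (simp only: \<phi>(2) mem_cball_0)
    then show "x = y" using xy by (simp add: inv(3))
  qed
  show "cball 0 1 \<subseteq> disc_fun (L disc_id) ` cball 0 1"
  proof
    fix w :: complex assume w: "w \<in> cball 0 1"
    obtain c \<psi> where \<psi>: "cmod c = 1" "norm \<psi> \<le> 1"
      "\<And>f z. cmod z \<le> 1 \<Longrightarrow> disc_fun (inv L f) z = c * disc_fun f (disc_fun \<psi> z)"
      using surjective_isometry_composition[OF inv(1)] by metis
    have cw: "cmod (c * w) \<le> 1" using w \<psi>(1) by (simp add: norm_mult)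
    have "c * disc_fun (L disc_id) (disc_fun \<psi> (c * w)) = c * w"
      using \<psi>(3)[OF cw, of "L disc_id"] disc_fun_disc_id[OF cw] unfolding inv(2) by (rule trans[OF sym])
    moreover have "c \<noteq> 0" using \<psi>(1) by auto
    ultimately have "disc_fun (L disc_id) (disc_fun \<psi> (c * w)) = w" by simp
    moreover have "disc_fun \<psi> (c * w) \<in> cball 0 1"
      using cmod_disc_fun_le_norm[of \<psi> "c * w"] \<psi>(2) by simp
    ultimately show "w \<in> disc_fun (L disc_id) ` cball 0 1" by (metis imageI)
  qed
  show "cmod z = 1 \<Longrightarrow> cmod (disc_fun (L disc_id) z) = 1"
    using surjective_isometry_weighted_evaluation[OF L, of z]
    by (metis disc_fun_disc_id mult.right_neutral norm_mult order_refl)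
qed


section \<open>Limits of disc automorphisms\<close>

text \<open>Composing \<open>g\<close> with the Moebius map \<open>m\<close> that sends \<open>g(0)\<close> to \<open>0\<close> gives a bijection of the disc
  fixing the origin. The Schwarz lemma for this map and for its inverse shows that it is a rotation,
  so the inverse of \<open>g\<close> is \<open>m\<close> followed by a rotation, and this is continuous on the closed disc.\<close>

lemma disc_automorphism_left_inverse:
  fixes g :: "complex \<Rightarrow> complex"
  assumes g: "g holomorphic_on ball 0 1" "bij_betw g (ball 0 1) (ball 0 1)"
  obtains \<rho> where "continuous_on (cball 0 1) \<rho>" "\<rho> holomorphic_on ball 0 1"
    "\<rho> ` ball 0 1 \<subseteq> ball 0 1" "\<rho> ` cball 0 1 \<subseteq> cball 0 1"
    "\<And>z. cmod z < 1 \<Longrightarrow> \<rho> (g z) = z"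
proof -
  have g_in: "cmod (g z) < 1" if "cmod z < 1" for z
    using g(2) that unfolding bij_betw_def by (metis image_eqI mem_ball_0)
  \<comment> \<open>\<open>m \<circ> g\<close> fixes the origin, and \<open>k \<circ> n\<close> is its inverse, with \<open>n\<close> inverse to \<open>m\<close> and \<open>k\<close> to \<open>g\<close>.\<close>
  define b where "b = g 0"
  have b: "cmod b < 1" unfolding b_def by (rule g_in) simp
  define m where "m = Moebius_function 0 b"
  define n where "n = Moebius_function 0 (- b)"
  have m: "m holomorphic_on ball 0 1" "\<And>z. cmod z < 1 \<Longrightarrow> cmod (m z) < 1"
    and n: "n holomorphic_on ball 0 1" "\<And>z. cmod z < 1 \<Longrightarrow> cmod (n z) < 1"
    and nm: "\<And>z. cmod z < 1 \<Longrightarrow> n (m z) = z"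
    unfolding m_def n_def using b
    by (auto intro: Moebius_function_holomorphic Moebius_function_norm_lt_1
        Moebius_function_compose)
  obtain k where k: "k holomorphic_on g ` ball 0 1" "\<And>z. z \<in> ball 0 1 \<Longrightarrow> k (g z) = z"
    using holomorphic_has_inverse[OF g(1) open_ball] g(2) unfolding bij_betw_def by metis
  have image: "g ` ball 0 1 = ball 0 1" using g(2) by (simp add: bij_betw_def)
  have k_in: "cmod (k w) < 1" if "cmod w < 1" for w
  proof -
    have "w \<in> g ` ball 0 1" using that image by simp
    then show ?thesis using k(2) by auto
  qed
  have hol: "(m \<circ> g) holomorphic_on ball 0 1" "(k \<circ> n) holomorphic_on ball 0 1"
    using g(1) m(1) g_in k(1) n unfolding image
    by (auto intro!: holomorphic_on_compose_gen[of _ _ _ "ball 0 1"] simp del: o_apply)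
  have mg0: "(m \<circ> g) 0 = 0"
    by (simp add: m_def b_def[symmetric] Moebius_function_eq_zero)
  have inverse: "(k \<circ> n) ((m \<circ> g) z) = z" if "cmod z < 1" for z
    using that by (simp add: nm g_in k(2))
  have kn0: "(k \<circ> n) 0 = 0" using inverse[of 0] mg0 by simp
  have "cmod ((m \<circ> g) z) \<le> cmod z" "cmod ((k \<circ> n) z) \<le> cmod z" if "cmod z < 1" for z
    using Schwarz_Lemma(1)[OF hol(1) mg0 _ that] Schwarz_Lemma(1)[OF hol(2) kn0 _ that]
      m(2) n(2) g_in k_in by simp_all
  then have "cmod ((m \<circ> g) z) = cmod z" if "cmod z < 1" for z
    using that inverse[OF that] m(2) g_in by (metis comp_apply order_antisym)
  from this[of "1/2"]
  have "\<exists>z. cmod z < 1 \<and> z \<noteq> 0 \<and> cmod ((m \<circ> g) z) = cmod z"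
    by (intro exI[of _ "1/2"]) auto
  then obtain a where a: "\<And>z. cmod z < 1 \<Longrightarrow> (m \<circ> g) z = a * z" "cmod a = 1"
    using Schwarz_Lemma(3)[OF hol(1) mg0, of 0] m(2) g_in by auto
  define \<rho> where "\<rho> = (\<lambda>w. cnj a * m w)"
  have "1 - cnj b * z \<noteq> 0" if "cmod z \<le> 1" for z
  proof
    assume "1 - cnj b * z = 0"
    then have "cmod (cnj b * z) = 1" by simp
    moreover have "cmod b * cmod z \<le> cmod b" using that by (simp add: mult_left_le)
    ultimately show False using b by (simp add: norm_mult)
  qed
  then have cont: "continuous_on (cball 0 1) \<rho>"
    unfolding \<rho>_def m_def Moebius_function_def by (intro continuous_intros) auto
  moreover have "\<rho> holomorphic_on ball 0 1"
    unfolding \<rho>_def by (intro holomorphic_intros m)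
  moreover have ball: "\<rho> ` ball 0 1 \<subseteq> ball 0 1"
    using a(2) m(2) by (auto simp: \<rho>_def norm_mult)
  moreover have "\<rho> ` cball 0 1 \<subseteq> cball 0 1"
  proof -
    have "\<rho> ` ball 0 1 \<subseteq> cball 0 1" using ball ball_subset_cball by (rule order_trans)
    then show ?thesis
      using image_closure_subset[of "ball 0 1" \<rho> "cball 0 1"] cont by simp
  qed
  moreover have "\<rho> (g z) = z" if "cmod z < 1" for z
  proof -
    have "cnj a * a = 1" using complex_norm_square[of a] a(2) by (simp add: mult.commute)
    then show ?thesis using a(1)[OF that] by (simp add: \<rho>_def mult.assoc[symmetric])
  qed
  ultimately show ?thesis by (rule that)
qed

lemma uniform_limit_disc_fun:
  assumes "G \<longlonglongrightarrow> g"
  shows "uniform_limit UNIV (\<lambda>n. disc_fun (G n)) (disc_fun g) sequentially"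
  unfolding uniform_limit_iff
proof (intro allI impI)
  fix e :: real assume "e > 0"
  with assms have "\<forall>\<^sub>F n in sequentially. dist (G n) g < e" by (rule tendstoD)
  then show "\<forall>\<^sub>F n in sequentially. \<forall>z\<in>UNIV. dist (disc_fun (G n) z) (disc_fun g z) < e"
  proof eventually_elim
    case (elim n)
    show ?case
    proof
      fix z
      show "dist (disc_fun (G n) z) (disc_fun g z) < e"
        using elim cmod_disc_fun_le_norm[of "G n - g" z]
        by (simp add: dist_norm disc_fun_simps)
    qed
  qed
qed

lemma tendsto_disc_fun:
  "G \<longlonglongrightarrow> g \<Longrightarrow> (\<lambda>n. disc_fun (G n) z) \<longlonglongrightarrow> disc_fun g z"
  using tendsto_uniform_limitI[OF uniform_limit_disc_fun] by simp

text \<open>A uniform limit of maps of the compact disc onto itself is onto, since its range is closed and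
  comes arbitrarily close to every point. So the limit is not constant, and both Hurwitz's theorem
  and the maximum principle apply. Surjectivity of each \<open>G n\<close> is what rules out a limit of disc
  automorphisms that degenerate to a constant.\<close>

lemma limit_of_disc_automorphisms:
  assumes lim: "G \<longlonglongrightarrow> g"
    and inj: "\<And>n. inj_on (disc_fun (G n)) (cball 0 1)"
    and surj: "\<And>n. cball 0 1 \<subseteq> disc_fun (G n) ` cball 0 1"
    and circle: "\<And>n z. cmod z = 1 \<Longrightarrow> cmod (disc_fun (G n) z) = 1"
  shows "bij_betw (disc_fun g) (ball 0 1) (ball 0 1)"
    and "cmod z = 1 \<Longrightarrow> cmod (disc_fun g z) = 1"
proof -
  show g_circle: "cmod (disc_fun g z) = 1" if "cmod z = 1" for z
    using tendsto_norm[OF tendsto_disc_fun[OF lim, of z]] circle[OF that]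
    by (simp add: LIMSEQ_const_iff)
  obtain x where "cmod x = 1" "cmod (disc_fun g x) = norm g" by (rule norm_attained_on_circle)
  then have norm: "norm g \<le> 1" using g_circle by simp
  have surj_g: "w \<in> disc_fun g ` cball 0 1" if w: "cmod w \<le> 1" for w
  proof -
    have "closed (disc_fun g ` cball 0 1)"
      by (intro compact_imp_closed compact_continuous_image continuous_disc_fun compact_cball)
    moreover have "\<exists>y\<in>disc_fun g ` cball 0 1. dist y w < e" if "e > 0" for e
    proof -
      have "\<forall>\<^sub>F n in sequentially. \<forall>z\<in>UNIV. dist (disc_fun (G n) z) (disc_fun g z) < e"
        using uniform_limit_disc_fun[OF lim] that by (simp add: uniform_limit_iff)
      then obtain n where n: "\<forall>z\<in>UNIV. dist (disc_fun (G n) z) (disc_fun g z) < e"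
        using eventually_happens'[OF sequentially_bot] by blast
      obtain z where "z \<in> cball 0 1" "w = disc_fun (G n) z" using surj[of n] w by auto
      with n show ?thesis by (auto simp: dist_commute)
    qed
    ultimately show ?thesis using closed_approachable by blast
  qed
  have nonconst: "\<exists>y. cmod y \<le> 1 \<and> disc_fun g y \<noteq> v" for v
    using surj_g[of 0] surj_g[of 1] by (metis imageE mem_cball_0 norm_one norm_zero order_refl zero_le_one zero_neq_one)
  have inside: "cmod (disc_fun g z) < 1" if z: "cmod z < 1" for z
  proof (rule ccontr)
    assume "\<not> cmod (disc_fun g z) < 1"
    with cmod_disc_fun_le_norm[of g z] norm have "cmod (disc_fun g z) = 1" by simp
    with const_if_max_inside[OF norm z] nonconst[of "disc_fun g z"] show False by blast
  qed
  have image: "disc_fun g ` ball 0 1 = ball 0 1"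
  proof
    show "disc_fun g ` ball 0 1 \<subseteq> ball 0 1" using inside by auto
    show "ball 0 1 \<subseteq> disc_fun g ` ball 0 1"
    proof
      fix w :: complex assume w: "w \<in> ball 0 1"
      then obtain z where z: "cmod z \<le> 1" "w = disc_fun g z" using surj_g[of w] by auto
      with w g_circle[of z] have "cmod z \<noteq> 1" by auto
      with z show "w \<in> disc_fun g ` ball 0 1" by auto
    qed
  qed
  have "inj_on (disc_fun g) (ball 0 1)"
  proof (rule Hurwitz_injective[where \<F> = "\<lambda>n. disc_fun (G n)"])
    show "\<not> disc_fun g constant_on ball 0 1"
    proof
      assume "disc_fun g constant_on ball 0 1"
      then obtain v where v: "disc_fun g ` ball 0 1 \<subseteq> {v}" unfolding constant_on_def by auto
      have "(0::complex) \<in> ball 0 1" "(1/2::complex) \<in> ball 0 1" by auto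
      with v have "(0::complex) = v" "(1/2::complex) = v" unfolding image by blast+
      then show False by simp
    qed
    show "inj_on (disc_fun (G n)) (ball 0 1)" for n
      using inj[of n] ball_subset_cball by (rule inj_on_subset)
  qed (auto intro: holomorphic_disc_fun uniform_limit_on_subset[OF uniform_limit_disc_fun[OF lim]])
  with image show "bij_betw (disc_fun g) (ball 0 1) (ball 0 1)" by (simp add: bij_betw_def)
qed


section \<open>Topological reflexivity\<close>

lemma ref_to_obtain_sequence:
  assumes "T \<in> ref_to S"
  obtains L where "\<And>n::nat. L n \<in> S" "(\<lambda>n. L n f) \<longlonglongrightarrow> T f"
proof -
  have "T f \<in> closure {L f |L. L \<in> S}" using assms by (simp add: ref_to_def)
  then obtain x where x: "\<And>n. x n \<in> {L f |L. L \<in> S}" "x \<longlonglongrightarrow> T f"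
    unfolding closure_sequential by blast
  then have "\<forall>n. \<exists>L. L \<in> S \<and> x n = L f" by blast
  then obtain L where "\<And>n. L n \<in> S" "\<And>n. x n = L n f" by metis
  moreover from this have "x = (\<lambda>n. L n f)" by auto
  ultimately show ?thesis using x(2) that by blast
qed

lemma topologically_reflexiveI:
  assumes "S \<subseteq> bounded_operators" "ref_to S \<subseteq> S"
  shows "topologically_reflexive S"
proof -
  have "S \<subseteq> ref_to S"
  proof
    fix T assume "T \<in> S"
    then have "T f \<in> closure {L f |L. L \<in> S}" for f
      using closure_subset[of "{L f |L. L \<in> S}"] by blast
    with \<open>T \<in> S\<close> assms(1) show "T \<in> ref_to S" by (auto simp: ref_to_def)
  qed
  with assms show ?thesis by (auto simp: topologically_reflexive_def)
qed

text \<open>The point is surjectivity of \<open>T\<close>. With \<open>g\<close> the image of the identity function and \<open>c\<close> the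
  constant \<open>T 1\<close>, the operator turns out to be \<open>f \<mapsto> c \<cdot> (f \<circ> (g / c))\<close>, and \<open>g\<close> has a left inverse
  \<open>\<rho>\<close> on the closed disc, so \<open>z \<mapsto> h(\<rho>(c z)) / c\<close> is a preimage of \<open>h\<close>.\<close>

lemma ref_to_isometry_group_subset:
  "ref_to (isometry_group :: (disc_algebra \<Rightarrow> disc_algebra) set) \<subseteq> isometry_group"
proof
  fix T :: "disc_algebra \<Rightarrow> disc_algebra"
  assume ref: "T \<in> ref_to isometry_group"
  then have T: "T \<in> bounded_operators" by (simp add: ref_to_def)
  have norm: "norm (T f) = norm f" for f
  proof -
    obtain L where L: "\<And>n::nat. L n \<in> isometry_group" "(\<lambda>n. L n f) \<longlonglongrightarrow> T f"
      using ref_to_obtain_sequence[OF ref] by blast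
    from tendsto_norm[OF L(2)] show ?thesis
      by (simp add: isometry_groupD(3)[OF L(1)] LIMSEQ_const_iff)
  qed
  define c where "c = disc_fun (T 1) 0"
  have c: "disc_fun (T 1) z = c" "cmod c = 1" if "cmod z \<le> 1" for z
  proof -
    obtain L where L: "\<And>n::nat. L n \<in> isometry_group" "(\<lambda>n. L n 1) \<longlonglongrightarrow> T 1"
      using ref_to_obtain_sequence[OF ref] by blast
    have one: "disc_fun (L n 1) z = disc_fun (L n 1) 0 \<and> cmod (disc_fun (L n 1) 0) = 1" for n
    proof -
      obtain a where "cmod a = 1" "L n 1 = a *\<^sub>C 1"
        by (rule surjective_isometry_one[OF L(1)])
      with that show ?thesis by (simp add: disc_fun_simps)
    qed
    have "(\<lambda>n. disc_fun (L n 1) z) = (\<lambda>n. disc_fun (L n 1) 0)" using one by blast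
    then have "(\<lambda>n. disc_fun (L n 1) 0) \<longlonglongrightarrow> disc_fun (T 1) z"
      using tendsto_disc_fun[OF L(2), of z] by simp
    then show "disc_fun (T 1) z = c"
      unfolding c_def using tendsto_disc_fun[OF L(2)] by (rule LIMSEQ_unique)
    have "(\<lambda>n. cmod (disc_fun (L n 1) 0)) = (\<lambda>n. 1)" using one by blast
    then show "cmod c = 1" unfolding c_def
      using tendsto_norm[OF tendsto_disc_fun[OF L(2), of 0]] by (simp add: LIMSEQ_const_iff)
  qed
  have c1: "cmod c = 1" using c(2)[of 0] by simp
  have cc: "c * cnj c = 1" "cnj c * c = 1"
    using complex_norm_square[of c] c1 by (simp_all add: mult.commute)
  define g where "g = T disc_id"
  obtain L where L: "\<And>n::nat. L n \<in> isometry_group" "(\<lambda>n. L n disc_id) \<longlonglongrightarrow> g"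
    using ref_to_obtain_sequence[OF ref] unfolding g_def by blast
  note surj_id = surjective_isometry_disc_id[OF L(1)]
  have bij: "bij_betw (disc_fun g) (ball 0 1) (ball 0 1)"
    and circle: "\<And>z. cmod z = 1 \<Longrightarrow> cmod (disc_fun g z) = 1"
    using limit_of_disc_automorphisms[OF L(2) surj_id] by auto
  obtain \<rho> where \<rho>: "continuous_on (cball 0 1) \<rho>" "\<rho> holomorphic_on ball 0 1"
    "\<rho> ` ball 0 1 \<subseteq> ball 0 1" "\<rho> ` cball 0 1 \<subseteq> cball 0 1"
    "\<And>z. cmod z < 1 \<Longrightarrow> \<rho> (disc_fun g z) = z"
    using disc_automorphism_left_inverse[OF holomorphic_disc_fun bij] by blast
  have left_inv: "\<rho> (disc_fun g z) = z" if z: "cmod z \<le> 1" for z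
  proof -
    have "norm g \<le> 1"
      using norm_attained_on_circle[of g] circle by (metis order_refl)
    then have g_in: "disc_fun g ` cball 0 1 \<subseteq> cball 0 1"
      using cmod_disc_fun_le_norm[of g] order_trans by (fastforce simp: image_subset_iff)
    have "continuous_on (closure (ball 0 1)) (\<lambda>z. \<rho> (disc_fun g z) - z)"
      using continuous_on_compose2[OF \<rho>(1) continuous_disc_fun g_in]
      by (auto intro!: continuous_intros)
    from continuous_constant_on_closure[OF this, of 0 z] z \<rho>(5) show ?thesis by simp
  qed
  have eval: "disc_fun (T f) z = c * disc_fun f (cnj c * disc_fun g z)" if z: "cmod z = 1" for f z
  proof -
    have "cmod (cnj c * disc_fun g z) = 1" using c1 circle[OF z] by (simp add: norm_mult)
    \<comment> \<open>The point of the circle seen from some \<open>y\<close> is chosen so that \<open>y\<close> must equal \<open>z\<close>: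
        the identity function gives \<open>g(y) = g(z)\<close>, and \<open>g\<close> is injective on the closed disc.\<close>
    then obtain y where y: "cmod y = 1"
      "\<And>f. disc_fun (T f) y = disc_fun f (cnj c * disc_fun g z) * disc_fun (T 1) y"
      using isometry_weighted_evaluation[OF T norm] by blast
    have "disc_fun g y = (c * cnj c) * disc_fun g z"
      using y(2)[of disc_id] y(1) \<open>cmod (cnj c * disc_fun g z) = 1\<close>
      by (simp add: g_def c(1) mult_ac)
    then have "disc_fun g y = disc_fun g z" by (simp add: cc)
    then have "y = z" using left_inv y(1) z by (metis order_refl)
    with y(2)[of f] c(1)[of z] z show ?thesis by (simp add: mult.commute)
  qed
  have "surj T"
  proof (rule surjI)
    fix h
    define f where "f = cnj c *\<^sub>C disc_of (\<lambda>z. disc_fun h (\<rho> (c * z)))"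
    have rot: "continuous_on (cball 0 1) (\<lambda>z. c * z)" "(\<lambda>z. c * z) holomorphic_on ball 0 1"
      "(\<lambda>z. c * z) ` cball 0 1 \<subseteq> cball 0 1" "(\<lambda>z. c * z) ` ball 0 1 \<subseteq> ball 0 1"
      using c1 by (auto intro!: continuous_intros holomorphic_intros simp: norm_mult)
    have f: "disc_fun f z = cnj c * disc_fun h (\<rho> (c * z))" if "cmod z \<le> 1" for z
    proof -
      have "disc_fun (disc_of (\<lambda>z. disc_fun h (\<rho> (c * z)))) z = disc_fun h (\<rho> (c * z))"
      proof (rule disc_fun_disc_of_compose)
        show "continuous_on (cball 0 1) (\<lambda>z. \<rho> (c * z))"
          by (rule continuous_on_compose2[OF \<rho>(1) rot(1,3)])
        show "(\<lambda>z. \<rho> (c * z)) holomorphic_on ball 0 1"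
          using holomorphic_on_compose_gen[OF rot(2) \<rho>(2) rot(4)] by (simp add: o_def)
      qed (use \<rho>(3,4) rot(3,4) that in blast)+
      then show ?thesis by (simp add: f_def disc_fun_simps)
    qed
    have "T f = h"
    proof (rule eq_if_eq_on_circle)
      fix z :: complex assume z: "cmod z = 1"
      have "cmod (cnj c * disc_fun g z) \<le> 1" using c1 circle[OF z] by (simp add: norm_mult)
      then show "disc_fun (T f) z = disc_fun h z"
        using eval[OF z, of f] z by (simp add: f mult.assoc[symmetric] cc left_inv)
    qed
    then show "T (cnj c *\<^sub>C disc_of (\<lambda>z. disc_fun h (\<rho> (c * z)))) = h" unfolding f_def .
  qed
  with T norm show "T \<in> isometry_group" by (simp add: isometry_group_def)
qed

text \<open>A value \<open>l\<close> of \<open>A f\<close> with \<open>\<bar>l\<bar> > \<parallel>f\<parallel>\<close> is impossible: \<open>f - l\<close> would be invertible, hence also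
  \<open>A f - l\<close>, which has a zero. The hypotheses are purely algebraic, so that the inverse of
  an automorphism satisfies them as well.\<close>

lemma norm_multiplicative_le:
  fixes A :: "disc_algebra \<Rightarrow> disc_algebra"
  assumes mult: "\<And>f g. A (f * g) = A f * A g" and one: "A 1 = 1"
    and diff: "\<And>f g. A (f - g) = A f - A g" and scale: "\<And>c f. A (c *\<^sub>C f) = c *\<^sub>C A f"
  shows "norm (A f) \<le> norm f"
proof (rule norm_disc_algebra_leI, rule ccontr)
  fix z :: complex assume z: "z \<in> cball 0 1"
  define l where "l = disc_fun (A f) z"
  assume "\<not> cmod (disc_fun (A f) z) \<le> norm f"
  then have "disc_fun f y \<noteq> l" for y
    using cmod_disc_fun_le_norm[of f y] by (auto simp: l_def)
  then have "disc_fun (f - l *\<^sub>C 1) y \<noteq> 0" if "cmod y \<le> 1" for y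
    using that by (simp add: disc_fun_simps)
  then obtain g where "(f - l *\<^sub>C 1) * g = 1" using invertible_if_nonvanishing by blast
  then have "(A f - l *\<^sub>C 1) * A g = 1" by (metis mult one diff scale)
  then have "disc_fun ((A f - l *\<^sub>C 1) * A g) z = 1" using z by (simp add: disc_fun_simps)
  then show False using z by (simp add: disc_fun_simps l_def)
qed

lemma automorphism_one:
  assumes "A \<in> (automorphism_group :: (disc_algebra \<Rightarrow> disc_algebra) set)"
  shows "A 1 = 1"
proof -
  have "surj A" "\<And>f g. A (f * g) = A f * A g"
    using assms by (auto simp: automorphism_group_def bij_def)
  then show ?thesis by (metis mult_1 mult.right_neutral surjD)
qed

lemma automorphism_group_subset_isometry_group:
  "(automorphism_group :: (disc_algebra \<Rightarrow> disc_algebra) set) \<subseteq> isometry_group"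
proof
  fix A :: "disc_algebra \<Rightarrow> disc_algebra" assume A: "A \<in> automorphism_group"
  then have bounded: "A \<in> bounded_operators" and bij: "bij A"
    and mult: "\<And>f g. A (f * g) = A f * A g"
    by (auto simp: automorphism_group_def)
  have right: "A (inv A f) = f" for f using bij by (simp add: bij_def surj_f_inv_f)
  have left: "inv A (A f) = f" for f using bij by (simp add: bij_def)
  note hom = mult automorphism_one[OF A] bounded_operators_diff[OF bounded]
    bounded_operators_scaleC[OF bounded]
  have "norm (A f) \<le> norm f" for f by (rule norm_multiplicative_le) (fact hom)+
  moreover have "norm f \<le> norm (A f)" for f
  proof -
    have "norm (inv A (A f)) \<le> norm (A f)"
      by (rule norm_multiplicative_le) (metis left right hom)+
    then show ?thesis by (simp add: left)
  qed
  ultimately show "A \<in> isometry_group"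
    using bounded bij by (simp add: isometry_group_def bij_def antisym)
qed

lemma ref_to_mono:
  assumes "S \<subseteq> S'" shows "ref_to S \<subseteq> ref_to S'"
proof -
  have "closure {L f |L. L \<in> S} \<subseteq> closure {L f |L. L \<in> S'}" for f
    using assms by (intro closure_mono) blast
  then show ?thesis unfolding ref_to_def by blast
qed

lemma ref_to_automorphism_group_subset:
  "ref_to (automorphism_group :: (disc_algebra \<Rightarrow> disc_algebra) set) \<subseteq> automorphism_group"
proof
  fix T :: "disc_algebra \<Rightarrow> disc_algebra"
  assume ref: "T \<in> ref_to automorphism_group"
  then have T: "T \<in> isometry_group"
    using ref_to_mono[OF automorphism_group_subset_isometry_group] ref_to_isometry_group_subset
    by blast
  note TD = isometry_groupD[OF T]
  obtain L where L: "\<And>n::nat. L n \<in> automorphism_group" "(\<lambda>n. L n 1) \<longlonglongrightarrow> T 1"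
    using ref_to_obtain_sequence[OF ref] by blast
  then have "T 1 = 1" by (simp add: automorphism_one[OF L(1)] LIMSEQ_const_iff)
  then have "T (f * g) = T f * T g" for f g using surjective_isometry_mult[OF T, of f g] by simp
  moreover have "bij T" using inj_isometry[OF TD(1,3)] TD(2) by (simp add: bij_def)
  ultimately show "T \<in> automorphism_group" using TD(1) by (simp add: automorphism_group_def)
qed

theorem theorem6:
  "topologically_reflexive (isometry_group :: (disc_algebra \<Rightarrow> disc_algebra) set) \<and>
   topologically_reflexive (automorphism_group :: (disc_algebra \<Rightarrow> disc_algebra) set)"
  using ref_to_isometry_group_subset ref_to_automorphism_group_subset
  by (auto intro!: topologically_reflexiveI
      simp: isometry_group_def automorphism_group_def)

end
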